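(* Let $X$ be an infinite Tychonoff space and let $G_1,G_2$ be non-trivial metrizable arc-connected topological groups. Then: (a) Player II has a winning strategy in $CFT(C_p(X,G_1),\mathbf{e}_1)$ if and only if Player II has a winning strategy in $CFT(C_p(X,G_2),\mathbf{e}_2)$. (b) Player II has a winning strategy in $CFT(C_p(X,G_1\times G_2),(\mathbf{e}_1,\mathbf{e}_2))$ if and only if Player II has a winning strategy in $CFT(C_p(X,G_1),\mathbf{e}_1)$. Moreover, (a) and (b) also hold with the game $CFT$ replaced throughout by the game $SCFT$.
   Context: Tychonoff means completely regular Hausdorff. A topological group $G$ is arc-connected if any two distinct points of $G$ are joined by a topological embedding $[0,1]\hookrightarrow G$. $C_p(X,G)$ is the space of all continuous functions $X\to G$ with the topology of pointwise convergence. For $i=1,2$, $\mathbf{e}_i\in C_p(X,G_i)$ is the constant function whose value is the identity of $G_i$; $G_1\times G_2$ is the product topological group, and $(\mathbf{e}_1,\mathbf{e}_2)\in C_p(X,G_1\times G_2)$ is the constant function whose value is the identity of $G_1\times G_2$. For a space $Y$ and $y\in Y$, let $\Omega_y=\{A\subset Y: y\in\overline{A}\setminus A\}$. The countable fan tightness game $CFT(Y,y)$ is played in innings $n\in\mathbb{N}=\{1,2,\dots\}$: in inning $n$ Player I chooses $A_n\in\Omega_y$ and Player II responds with a finite subset $B_n\subset A_n$; Player II wins if $y\in\overline{\bigcup_n B_n}$, otherwise Player I wins. The countable strong fan tightness game $SCFT(Y,y)$ is the same except that Player II responds with a single element $b_n\in A_n$, and Player II wins if $y\in\overline{\{b_n:n\in\mathbb{N}\}}$.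 A strategy for Player II is a function $\sigma$ on $\bigcup_{n\ge1}(\Omega_y)^n$ assigning to each $(A_1,\dots,A_n)$ a legal response to $A_n$ (a finite subset of $A_n$, respectively an element of $A_n$); it is winning if, for every sequence $(A_n)_n$ of moves of Player I, Player II wins by responding with $\sigma(A_1,\dots,A_n)$ in each inning $n$. *)

theory Defs
  imports "HOL-Analysis.Analysis" "HOL-Algebra.Group"
begin

text \<open>A topological group is given by a group together with a topology on its carrier.\<close>

definition topological_group :: "('a, 'm) monoid_scheme \<Rightarrow> 'a topology \<Rightarrow> bool" where
  "topological_group G T \<longleftrightarrow>
     group G \<and> topspace T = carrier G \<and>
     continuous_map (prod_topology T T) T (\<lambda>(x, y). x \<otimes>\<^bsub>G\<^esub> y) \<and>
     continuous_map T T (\<lambda>x. inv\<^bsub>G\<^esub> x)"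

definition arc_connected_space :: "'a topology \<Rightarrow> bool" where
  "arc_connected_space T \<longleftrightarrow>
     (\<forall>x\<in>topspace T. \<forall>y\<in>topspace T. x \<noteq> y \<longrightarrow>
        (\<exists>\<gamma>. embedding_map (top_of_set {0..1::real}) T \<gamma> \<and> \<gamma> 0 = x \<and> \<gamma> 1 = y))"

text \<open>Points of \<open>product_topology\<close> are extensional: they take the value \<open>undefined\<close> outside
  \<open>topspace X\<close>, so each continuous function on \<open>X\<close> is represented exactly once.\<close>

definition Cp :: "'x topology \<Rightarrow> 'a topology \<Rightarrow> ('x \<Rightarrow> 'a) topology" where
  "Cp X T = subtopology (product_topology (\<lambda>_. T) (topspace X)) {f. continuous_map X T f}"

definition const_one :: "'x topology \<Rightarrow> ('a, 'm) monoid_scheme \<Rightarrow> 'x \<Rightarrow> 'a" where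
  "const_one X G = (\<lambda>x\<in>topspace X. \<one>\<^bsub>G\<^esub>)"

definition Omega :: "'a topology \<Rightarrow> 'a \<Rightarrow> 'a set set" where
  "Omega Y y = {A. A \<subseteq> topspace Y \<and> y \<in> Y closure_of A - A}"

text \<open>A strategy of Player II is applied to the list \<open>[A\<^sub>1, \<dots>, A\<^sub>n]\<close> of the moves that
  Player I has made so far; its values on the empty list and on lists containing an illegal move
  are irrelevant. A sequence of moves \<open>A\<close> is indexed from \<open>0\<close>, so that
  \<open>map A [0..<Suc n]\<close> lists the moves up to and including \<open>A n\<close>.\<close>

definition CFT_strategy :: "'a topology \<Rightarrow> 'a \<Rightarrow> ('a set list \<Rightarrow> 'a set) \<Rightarrow> bool" where
  "CFT_strategy Y y \<sigma> \<longleftrightarrow>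
     (\<forall>As. As \<noteq> [] \<and> set As \<subseteq> Omega Y y \<longrightarrow> finite (\<sigma> As) \<and> \<sigma> As \<subseteq> last As)"

definition CFT_winning_strategy :: "'a topology \<Rightarrow> 'a \<Rightarrow> ('a set list \<Rightarrow> 'a set) \<Rightarrow> bool" where
  "CFT_winning_strategy Y y \<sigma> \<longleftrightarrow> CFT_strategy Y y \<sigma> \<and>
     (\<forall>A. (\<forall>n. A n \<in> Omega Y y) \<longrightarrow>
        y \<in> Y closure_of (\<Union>n::nat. \<sigma> (map A [0..<Suc n])))"

definition II_wins_CFT :: "'a topology \<Rightarrow> 'a \<Rightarrow> bool" where
  "II_wins_CFT Y y \<longleftrightarrow> (\<exists>\<sigma>. CFT_winning_strategy Y y \<sigma>)"

definition SCFT_strategy :: "'a topology \<Rightarrow> 'a \<Rightarrow> ('a set list \<Rightarrow> 'a) \<Rightarrow> bool" where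
  "SCFT_strategy Y y \<sigma> \<longleftrightarrow>
     (\<forall>As. As \<noteq> [] \<and> set As \<subseteq> Omega Y y \<longrightarrow> \<sigma> As \<in> last As)"

definition SCFT_winning_strategy :: "'a topology \<Rightarrow> 'a \<Rightarrow> ('a set list \<Rightarrow> 'a) \<Rightarrow> bool" where
  "SCFT_winning_strategy Y y \<sigma> \<longleftrightarrow> SCFT_strategy Y y \<sigma> \<and>
     (\<forall>A. (\<forall>n. A n \<in> Omega Y y) \<longrightarrow>
        y \<in> Y closure_of (range (\<lambda>n::nat. \<sigma> (map A [0..<Suc n]))))"

definition II_wins_SCFT :: "'a topology \<Rightarrow> 'a \<Rightarrow> bool" where
  "II_wins_SCFT Y y \<longleftrightarrow> (\<exists>\<sigma>. SCFT_winning_strategy Y y \<sigma>)"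

end

theory Submission
  imports Defs
begin

text \<open>
  No group structure is needed: if \<open>e\<close> has a decreasing neighbourhood base \<open>U\<^sub>n\<close> in one range space
  and the other range space has a path from \<open>e'\<close> to some \<open>g \<noteq> e'\<close>, a move \<open>A\<close> of Player I in
  inning \<open>n\<close> at the constant \<open>e\<close> is translated into the set of all continuous \<open>h\<close>, different from
  the constant \<open>e'\<close>, which take the value \<open>g\<close> off \<open>f\<inverse>(U\<^sub>n)\<close> for some \<open>f \<in> A\<close>; the answer \<open>h\<close> is
  translated back into such an \<open>f\<close>. If \<open>h\<close> avoids \<open>g\<close> on a finite set, then \<open>f\<close> maps that set into
  \<open>U\<^sub>n\<close>. Since the constant \<open>e'\<close> is never an answer, it stays in the closure of the answers when the
  finitely many early ones are discarded, so \<open>n\<close> can be taken as large as desired.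
\<close>

section \<open>The space of continuous functions\<close>

lemma topspace_Cp:
  "topspace (Cp X T) = {f \<in> extensional (topspace X). continuous_map X T f}"
  by (auto simp: Cp_def PiE_def continuous_map_def)

lemma const_in_topspace_Cp: "e \<in> topspace T \<Longrightarrow> (\<lambda>x\<in>topspace X. e) \<in> topspace (Cp X T)"
  by (auto simp: topspace_Cp intro: continuous_map_eq [of _ _ "\<lambda>x. e"])

lemma Hausdorff_space_Cp: "Hausdorff_space T \<Longrightarrow> Hausdorff_space (Cp X T)"
  by (simp add: Cp_def Hausdorff_space_product_topology Hausdorff_space_subtopology)

text \<open>This is a basic box of the product, with the coordinates in \<open>F\<close> confined to
  \<open>V\<close> and all others left free, cut down to the continuous functions.\<close>

lemma openin_Cp_finite:
  assumes "finite F" "F \<subseteq> topspace X" "openin T V"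
  shows "openin (Cp X T) {f \<in> topspace (Cp X T). f ` F \<subseteq> V}"
proof -
  let ?P = "Pi\<^sub>E (topspace X) (\<lambda>x. if x \<in> F then V else topspace T)"
  have "finite {x \<in> topspace X. (if x \<in> F then V else topspace T) \<noteq> topspace T}"
    by (rule finite_subset [OF _ \<open>finite F\<close>]) auto
  then have "openin (product_topology (\<lambda>_. T) (topspace X)) ?P"
    using assms(3) by (auto simp: openin_PiE_gen)
  moreover have "{f \<in> topspace (Cp X T). f ` F \<subseteq> V} = ?P \<inter> {f. continuous_map X T f}"
  proof (intro Set.set_eqI iffI)
    fix f assume f: "f \<in> {f \<in> topspace (Cp X T). f ` F \<subseteq> V}"
    then have cf: "continuous_map X T f" and "f \<in> extensional (topspace X)"
      by (auto simp: topspace_Cp)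
    moreover have "f x \<in> topspace T" if "x \<in> topspace X" for x
      using continuous_map_image_subset_topspace [OF cf] that by blast
    ultimately show "f \<in> ?P \<inter> {f. continuous_map X T f}"
      using f by (auto simp: PiE_iff)
  next
    fix f assume f: "f \<in> ?P \<inter> {f. continuous_map X T f}"
    then have "f x \<in> V" if "x \<in> F" for x
      using assms(2) that by (auto simp: PiE_iff dest: bspec [of _ _ x])
    then show "f \<in> {f \<in> topspace (Cp X T). f ` F \<subseteq> V}"
      using f by (auto simp: topspace_Cp PiE_iff)
  qed
  ultimately show ?thesis
    unfolding Cp_def by (auto simp: openin_subtopology)
qed

text \<open>A basic box around a constant restricts only finitely many coordinates, and all its
  factors contain the same point \<open>e\<close>. Their intersection is therefore a neighbourhood
  of \<open>e\<close> that serves every restricted coordinate at once. All later closure arguments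
  use this form.\<close>

lemma const_in_closure_of_Cp:
  assumes "e \<in> topspace T" "A \<subseteq> topspace (Cp X T)"
  shows "(\<lambda>x\<in>topspace X. e) \<in> Cp X T closure_of A \<longleftrightarrow>
    (\<forall>F V. finite F \<and> F \<subseteq> topspace X \<and> openin T V \<and> e \<in> V \<longrightarrow> (\<exists>f\<in>A. f ` F \<subseteq> V))"
    (is "?c \<in> _ \<longleftrightarrow> ?R")
proof
  assume L: "?c \<in> Cp X T closure_of A"
  show ?R
  proof (intro allI impI)
    fix F V assume FV: "finite F \<and> F \<subseteq> topspace X \<and> openin T V \<and> e \<in> V"
    let ?W = "{f \<in> topspace (Cp X T). f ` F \<subseteq> V}"
    have "openin (Cp X T) ?W"
      using openin_Cp_finite FV by blast
    moreover have "?c \<in> ?W"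
      using FV const_in_topspace_Cp [OF assms(1)] by (auto simp: subset_iff)
    ultimately show "\<exists>f\<in>A. f ` F \<subseteq> V"
      using L [unfolded in_closure_of, THEN conjunct2, rule_format, of ?W] by auto
  qed
next
  assume R: ?R
  show "?c \<in> Cp X T closure_of A"
    unfolding in_closure_of
  proof (intro conjI allI impI)
    show "?c \<in> topspace (Cp X T)"
      by (rule const_in_topspace_Cp [OF assms(1)])
    fix W assume W: "?c \<in> W \<and> openin (Cp X T) W"
    then obtain S where S: "openin (product_topology (\<lambda>_. T) (topspace X)) S"
      and WS: "W = S \<inter> {f. continuous_map X T f}"
      unfolding Cp_def openin_subtopology by blast
    have "?c \<in> S" using W WS by auto
    from bspec [OF S [unfolded openin_product_topology_alt] this]
    obtain U where fin: "finite {x \<in> topspace X. U x \<noteq> topspace T}"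
      and U: "\<forall>x\<in>topspace X. openin T (U x)"
      and cU: "?c \<in> Pi\<^sub>E (topspace X) U" and US: "Pi\<^sub>E (topspace X) U \<subseteq> S"
      by blast
    define F where "F = {x \<in> topspace X. U x \<noteq> topspace T}"
    \<comment> \<open>The factor \<open>topspace T\<close> keeps \<open>V\<close> open when
      \<open>F\<close> is empty.\<close>
    define V where "V = (\<Inter>x\<in>F. U x) \<inter> topspace T"
    have "openin T V"
      unfolding V_def using fin U by (intro openin_INT) (auto simp: F_def)
    moreover have "e \<in> V"
      using cU assms(1) by (auto simp: V_def F_def PiE_iff)
    moreover have "finite F" "F \<subseteq> topspace X"
      using fin by (auto simp: F_def)
    ultimately obtain f where f: "f \<in> A" "f ` F \<subseteq> V"
      using R [rule_format, of F V] by auto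
    have ft: "f \<in> extensional (topspace X)" "continuous_map X T f"
      using f(1) assms(2) by (auto simp: topspace_Cp)
    have "f x \<in> U x" if x: "x \<in> topspace X" for x
    proof (cases "x \<in> F")
      case True
      then show ?thesis using f(2) by (auto simp: V_def)
    next
      case False
      then have "U x = topspace T" using x by (simp add: F_def)
      then show ?thesis using ft(2) x by (auto simp: continuous_map_def)
    qed
    then have "f \<in> Pi\<^sub>E (topspace X) U" using ft(1) by (simp add: PiE_iff)
    then have "f \<in> S" using US by blast
    then show "\<exists>f. f \<in> A \<and> f \<in> W"
      using f(1) ft(2) WS by blast
  qed
qed

text \<open>Finite sets are compact, so complete regularity gives a function into the unit interval
  that is 0 on \<open>F\<close> and 1 on \<open>C\<close>; following it by the path \<gamma> gives
  \<open>h\<close>.\<close>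

lemma Cp_step_function:
  assumes "completely_regular_space X"
    and "finite F" "F \<subseteq> topspace X" "closedin X C" "disjnt F C"
    and "continuous_map (top_of_set {0..1::real}) T \<gamma>"
  obtains h where "h \<in> topspace (Cp X T)" "\<And>x. x \<in> F \<Longrightarrow> h x = \<gamma> 0" "\<And>x. x \<in> C \<Longrightarrow> h x = \<gamma> 1"
proof -
  have "compactin X F"
    using assms by (simp add: finite_imp_compactin)
  moreover have "disjnt C F"
    using assms(5) by (simp add: disjnt_sym)
  ultimately obtain k where k: "continuous_map X (top_of_set {0..1::real}) k"
      "k ` F \<subseteq> {0}" "k ` C \<subseteq> {1}"
    using assms Urysohn_completely_regular_closed_compact [of 0 1 X C F] by auto
  \<comment> \<open>Restricting to \<open>topspace X\<close> makes the composite extensional, as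
    points of \<open>Cp X T\<close> must be.\<close>
  let ?h = "\<lambda>x\<in>topspace X. \<gamma> (k x)"
  have "continuous_map X T (\<gamma> \<circ> k)"
    using k(1) assms(6) by (rule continuous_map_compose)
  then have "continuous_map X T ?h"
    by (rule continuous_map_eq) simp
  then have "?h \<in> topspace (Cp X T)"
    by (simp add: topspace_Cp)
  moreover have "?h x = \<gamma> 0" if "x \<in> F" for x
    using k(2) that assms(3) by auto
  moreover have "?h x = \<gamma> 1" if "x \<in> C" for x
    using k(3) that closedin_subset [OF assms(4)] by auto
  ultimately show thesis
    using that by blast
qed

section \<open>Translating moves and answers\<close>

text \<open>Excluding the constant serves two purposes: membership in \<open>Omega\<close> demands
  it, and it allows finitely many answers to be discarded without losing the constant from the
  closure.\<close>

definition push_move :: "'x topology \<Rightarrow> 'b topology \<Rightarrow> 'b \<Rightarrow> 'b \<Rightarrow> 'a set \<Rightarrow> ('x \<Rightarrow> 'a) set \<Rightarrow> ('x \<Rightarrow> 'b) set"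
  where "push_move X T e g U A = {h \<in> topspace (Cp X T). h \<noteq> (\<lambda>x\<in>topspace X. e) \<and>
    (\<exists>f\<in>A. \<forall>x\<in>topspace X. f x \<notin> U \<longrightarrow> h x = g)}"

text \<open>A choice is made because \<open>h\<close> does not determine the \<open>f\<close> that
  witnesses its membership in \<open>push_move\<close>.\<close>

definition pull_answer :: "'x topology \<Rightarrow> 'b \<Rightarrow> 'a set \<Rightarrow> ('x \<Rightarrow> 'a) set \<Rightarrow> ('x \<Rightarrow> 'b) \<Rightarrow> 'x \<Rightarrow> 'a"
  where "pull_answer X g U A h = (SOME f. f \<in> A \<and> (\<forall>x\<in>topspace X. f x \<notin> U \<longrightarrow> h x = g))"

lemma pull_answer:
  assumes "h \<in> push_move X T e g U A"
  shows "pull_answer X g U A h \<in> A"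
    and "\<lbrakk>x \<in> topspace X; h x \<noteq> g\<rbrakk> \<Longrightarrow> pull_answer X g U A h x \<in> U"
proof -
  have "\<exists>f. f \<in> A \<and> (\<forall>x\<in>topspace X. f x \<notin> U \<longrightarrow> h x = g)"
    using assms by (auto simp: push_move_def)
  from someI_ex [OF this]
  show "pull_answer X g U A h \<in> A"
    and "\<lbrakk>x \<in> topspace X; h x \<noteq> g\<rbrakk> \<Longrightarrow> pull_answer X g U A h x \<in> U"
    by (auto simp: pull_answer_def)
qed

text \<open>Given \<open>F\<close> and \<open>V\<close>, some \<open>f\<close> in \<open>A\<close>
  maps \<open>F\<close> into \<open>U\<close>. By continuity of \<open>f\<close>, the points where
  \<open>f\<close> leaves \<open>U\<close> form a closed set disjoint from \<open>F\<close>, so a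
  step function can be \<open>e'\<close> on \<open>F\<close> and \<open>g\<close> on that
  set.\<close>

lemma push_move_Omega:
  assumes X: "infinite (topspace X)" "completely_regular_space X" "Hausdorff_space X"
    and U: "openin T U" "e \<in> U"
    and \<gamma>: "continuous_map (top_of_set {0..1::real}) T' \<gamma>" "\<gamma> 0 = e'" "\<gamma> 1 = g" "g \<noteq> e'"
    and A: "A \<in> Omega (Cp X T) (\<lambda>x\<in>topspace X. e)"
  shows "push_move X T' e' g U A \<in> Omega (Cp X T') (\<lambda>x\<in>topspace X. e')"
proof -
  let ?B = "push_move X T' e' g U A"
  have sub: "?B \<subseteq> topspace (Cp X T')" and notin: "(\<lambda>x\<in>topspace X. e') \<notin> ?B"
    by (auto simp: push_move_def)
  have e: "e \<in> topspace T"
    using U openin_subset by blast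
  have "\<gamma> \<in> {0..1} \<rightarrow> topspace T'"
    using \<gamma>(1) by (simp add: continuous_map_def)
  then have e': "e' \<in> topspace T'"
    using \<gamma>(2) by force
  have AT: "A \<subseteq> topspace (Cp X T)" and Acl: "(\<lambda>x\<in>topspace X. e) \<in> Cp X T closure_of A"
    using A by (auto simp: Omega_def)
  have "\<exists>h\<in>?B. h ` F \<subseteq> V"
    if FV: "finite F \<and> F \<subseteq> topspace X \<and> openin T' V \<and> e' \<in> V" for F V
  proof -
    obtain f where f: "f \<in> A" "f ` F \<subseteq> U"
      using Acl FV U unfolding const_in_closure_of_Cp [OF e AT] by meson
    have cf: "continuous_map X T f"
      using f(1) AT by (auto simp: topspace_Cp)
    \<comment> \<open>The extra point keeps \<open>h\<close> from being constant, even if \<open>f\<close> maps everything into \<open>U\<close>.\<close>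
    obtain z where z: "z \<in> topspace X" "z \<notin> F"
      using X(1) FV by (meson finite_subset subsetI)
    let ?C = "{x \<in> topspace X. f x \<in> topspace T - U} \<union> {z}"
    have "closedin X {x \<in> topspace X. f x \<in> topspace T - U}"
      using cf U(1) by (intro closedin_continuous_map_preimage) auto
    moreover have "closedin X {z}"
      using X(3) z(1) by (simp add: closedin_Hausdorff_finite)
    ultimately have "closedin X ?C"
      by (rule closedin_Un)
    moreover have "disjnt F ?C"
      using f(2) z(2) by (auto simp: disjnt_def)
    ultimately obtain h where h: "h \<in> topspace (Cp X T')" "\<And>x. x \<in> F \<Longrightarrow> h x = \<gamma> 0"
        "\<And>x. x \<in> ?C \<Longrightarrow> h x = \<gamma> 1"
      using Cp_step_function [OF X(2) _ _ _ _ \<gamma>(1), of F ?C] FV by blast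
    have "h z = g" using h(3) [of z] \<gamma>(3) by simp
    then have "h \<noteq> (\<lambda>x\<in>topspace X. e')"
      using z(1) \<gamma>(4) by (metis restrict_apply')
    moreover have "h x = g" if "x \<in> topspace X" "f x \<notin> U" for x
      using h(3) [of x] that cf \<gamma>(3) by (auto simp: continuous_map_def)
    ultimately have "h \<in> ?B"
      using h(1) f(1) by (auto simp: push_move_def)
    moreover have "h ` F \<subseteq> V"
      using h(2) \<gamma>(2) FV by auto
    ultimately show ?thesis by blast
  qed
  then have "(\<lambda>x\<in>topspace X. e') \<in> Cp X T' closure_of ?B"
    unfolding const_in_closure_of_Cp [OF e' sub] by blast
  then show ?thesis
    using sub notin by (auto simp: Omega_def)
qed

text \<open>Given \<open>F\<close> and \<open>V\<close>, choose \<open>m\<close> with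
  \<open>U m\<close> inside \<open>V\<close>. Some answer \<open>h\<close> from an inning
  \<open>n \<ge> m\<close> avoids \<open>g\<close> on \<open>F\<close>, and its translation then
  maps \<open>F\<close> into \<open>U n\<close>, hence into \<open>V\<close>.\<close>

lemma pull_answers_closure:
  assumes U: "\<And>n. openin T (U n)" "\<And>n. e \<in> U n" "decseq U"
      "\<And>V. openin T V \<Longrightarrow> e \<in> V \<Longrightarrow> \<exists>n. U n \<subseteq> V"
    and T': "Hausdorff_space T'" "e' \<in> topspace T'" "g \<noteq> e'"
    and A: "\<And>n. A n \<subseteq> topspace (Cp X T)"
    and S: "\<And>n. finite (S n)" "\<And>n. S n \<subseteq> push_move X T' e' g (U n) (A n)"
    and cl: "(\<lambda>x\<in>topspace X. e') \<in> Cp X T' closure_of (\<Union>n. S n)"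
  shows "(\<lambda>x\<in>topspace X. e) \<in> Cp X T closure_of (\<Union>n. pull_answer X g (U n) (A n) ` S n)"
proof -
  let ?c = "\<lambda>x\<in>topspace X. e'"
  have e: "e \<in> topspace T"
    using U(1,2) openin_subset by blast
  have ST: "S n \<subseteq> topspace (Cp X T')" for n
    using S(2) [of n] by (auto simp: push_move_def)
  have cS: "?c \<notin> S n" for n
    using S(2) [of n] by (auto simp: push_move_def)
  have sub: "(\<Union>n. pull_answer X g (U n) (A n) ` S n) \<subseteq> topspace (Cp X T)"
    using pull_answer(1) [OF subsetD [OF S(2)]] A by (auto dest: subsetD)
  have "\<exists>f\<in>(\<Union>n. pull_answer X g (U n) (A n) ` S n). f ` F \<subseteq> V"
    if FV: "finite F \<and> F \<subseteq> topspace X \<and> openin T V \<and> e \<in> V" for F V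
  proof -
    obtain m where m: "U m \<subseteq> V" using U(4) FV by blast
    \<comment> \<open>The answers before inning \<open>m\<close> form a finite set, closed in a
      Hausdorff space and missing the constant, so the constant is in the closure of the remaining
      answers.\<close>
    have "closedin (Cp X T') (\<Union>n<m. S n)"
      using S(1) ST by (intro closedin_Hausdorff_finite Hausdorff_space_Cp T') auto
    then have "?c \<notin> Cp X T' closure_of (\<Union>n<m. S n)"
      using cS by (simp add: closure_of_closedin)
    moreover have "(\<Union>n. S n) = (\<Union>n<m. S n) \<union> (\<Union>n\<in>{m..}. S n)"
      unfolding UN_Un [symmetric] by (rule arg_cong [where f = "\<lambda>I. \<Union> (S ` I)"]) auto
    ultimately have late: "?c \<in> Cp X T' closure_of (\<Union>n\<in>{m..}. S n)"
      using cl by simp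
    have late_sub: "(\<Union>n\<in>{m..}. S n) \<subseteq> topspace (Cp X T')"
      using ST by blast
    \<comment> \<open>Closeness of \<open>h\<close> to the constant matters only through avoiding
      \<open>g\<close>, so the complement of \<open>g\<close> is a small enough neighbourhood of
      \<open>e'\<close>.\<close>
    have "openin T' (topspace T' - {g})"
      using T'(1) by (simp add: open_in_Hausdorff_delete)
    moreover have "e' \<in> topspace T' - {g}"
      using T' by auto
    ultimately have "\<exists>h\<in>(\<Union>n\<in>{m..}. S n). h ` F \<subseteq> topspace T' - {g}"
      using late [unfolded const_in_closure_of_Cp [OF T'(2) late_sub], rule_format, of F] FV by simp
    then obtain n h where h: "n \<ge> m" "h \<in> S n" "h ` F \<subseteq> topspace T' - {g}"
      by auto
    have "pull_answer X g (U n) (A n) h x \<in> V" if "x \<in> F" for x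
    proof -
      have "pull_answer X g (U n) (A n) h x \<in> U n"
        using that h S(2) FV by (intro pull_answer(2)) auto
      then show ?thesis
        using m decseqD [OF U(3) h(1)] by blast
    qed
    then show ?thesis using h(2) by blast
  qed
  then show ?thesis
    unfolding const_in_closure_of_Cp [OF e sub] by blast
qed

section \<open>Translating strategies\<close>

text \<open>The translation depends on the inning, so the position in the list is passed along with
  the move.\<close>

definition push_moves :: "(nat \<Rightarrow> 'p set \<Rightarrow> 'q set) \<Rightarrow> 'p set list \<Rightarrow> 'q set list" where
  "push_moves t As = map (\<lambda>i. t i (As ! i)) [0..<length As]"

lemma push_moves_legal:
  assumes "As \<noteq> []" "set As \<subseteq> P" "\<And>n A. A \<in> P \<Longrightarrow> t n A \<in> Q"
  shows "push_moves t As \<noteq> []" "set (push_moves t As) \<subseteq> Q"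
    "last (push_moves t As) = t (length As - 1) (last As)"
  using assms by (auto simp: push_moves_def last_conv_nth subset_iff)

lemma push_moves_upt: "push_moves t (map A [0..<n]) = map (\<lambda>i. t i (A i)) [0..<n]"
  by (simp add: push_moves_def del: upt_Suc)

text \<open>Player II runs a simulated game at \<open>z\<close>: each move is carried over by
  \<open>t\<close>, answered there by the winning strategy, and the answer is brought back by
  \<open>p\<close>. The hypothesis \<open>closure\<close> speaks of arbitrary finite answers, so it
  does not involve the strategy.\<close>

lemma II_wins_CFT_translate:
  fixes t :: "nat \<Rightarrow> 'p set \<Rightarrow> 'q set" and p :: "nat \<Rightarrow> 'p set \<Rightarrow> 'q \<Rightarrow> 'p"
  assumes push: "\<And>n A. A \<in> Omega Y y \<Longrightarrow> t n A \<in> Omega Z z"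
    and pull: "\<And>n A h. \<lbrakk>A \<in> Omega Y y; h \<in> t n A\<rbrakk> \<Longrightarrow> p n A h \<in> A"
    and closure: "\<And>A S. \<lbrakk>\<And>n. A n \<in> Omega Y y; \<And>n. finite (S n); \<And>n. S n \<subseteq> t n (A n);
        z \<in> Z closure_of (\<Union>n. S n)\<rbrakk> \<Longrightarrow> y \<in> Y closure_of (\<Union>n. p n (A n) ` S n)"
    and win: "II_wins_CFT Z z"
  shows "II_wins_CFT Y y"
proof -
  obtain \<sigma> where \<sigma>: "CFT_strategy Z z \<sigma>"
    and \<sigma>_win: "\<And>B. (\<And>n. B n \<in> Omega Z z) \<Longrightarrow> z \<in> Z closure_of (\<Union>n. \<sigma> (map B [0..<Suc n]))"
    using win unfolding II_wins_CFT_def CFT_winning_strategy_def by blast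
  \<comment> \<open>Innings are counted from 0, so \<open>length As - 1\<close> is the current
    one.\<close>
  define \<tau> where "\<tau> As = p (length As - 1) (last As) ` \<sigma> (push_moves t As)" for As
  have legal: "finite (\<sigma> (push_moves t As)) \<and>
      \<sigma> (push_moves t As) \<subseteq> t (length As - 1) (last As)"
    if "As \<noteq> []" "set As \<subseteq> Omega Y y" for As
    using \<sigma> push_moves_legal [where t = t, OF that push] unfolding CFT_strategy_def by metis
  have "CFT_strategy Y y \<tau>"
    unfolding CFT_strategy_def
  proof (intro allI impI)
    fix As assume As: "As \<noteq> [] \<and> set As \<subseteq> Omega Y y"
    then have "last As \<in> Omega Y y" by (meson last_in_set subsetD)
    then show "finite (\<tau> As) \<and> \<tau> As \<subseteq> last As"
      using legal As pull unfolding \<tau>_def by blast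
  qed
  moreover have "y \<in> Y closure_of (\<Union>n. \<tau> (map A [0..<Suc n]))"
    if A: "\<forall>n. A n \<in> Omega Y y" for A
  proof -
    let ?S = "\<lambda>n. \<sigma> (push_moves t (map A [0..<Suc n]))"
    have "finite (?S n) \<and> ?S n \<subseteq> t n (A n)" for n
      using legal [of "map A [0..<Suc n]"] A by auto
    \<comment> \<open>The translated histories are the initial segments of one sequence
      \<open>t i (A i)\<close>, so these answers belong to a single play that follows
      \<sigma>.\<close>
    moreover have "z \<in> Z closure_of (\<Union>n. ?S n)"
      unfolding push_moves_upt using A push by (intro \<sigma>_win) blast
    ultimately have "y \<in> Y closure_of (\<Union>n. p n (A n) ` ?S n)"
      using A by (intro closure) auto
    then show ?thesis
      by (simp add: \<tau>_def)
  qed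
  ultimately show ?thesis
    unfolding II_wins_CFT_def CFT_winning_strategy_def by blast
qed

text \<open>The same simulation works with single answers: \<open>p\<close> is applied to a point
  instead of to a finite set.\<close>

lemma II_wins_SCFT_translate:
  fixes t :: "nat \<Rightarrow> 'p set \<Rightarrow> 'q set" and p :: "nat \<Rightarrow> 'p set \<Rightarrow> 'q \<Rightarrow> 'p"
  assumes push: "\<And>n A. A \<in> Omega Y y \<Longrightarrow> t n A \<in> Omega Z z"
    and pull: "\<And>n A h. \<lbrakk>A \<in> Omega Y y; h \<in> t n A\<rbrakk> \<Longrightarrow> p n A h \<in> A"
    and closure: "\<And>A s. \<lbrakk>\<And>n. A n \<in> Omega Y y; \<And>n. s n \<in> t n (A n);
        z \<in> Z closure_of (range s)\<rbrakk> \<Longrightarrow> y \<in> Y closure_of (range (\<lambda>n. p n (A n) (s n)))"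
    and win: "II_wins_SCFT Z z"
  shows "II_wins_SCFT Y y"
proof -
  obtain \<sigma> where \<sigma>: "SCFT_strategy Z z \<sigma>"
    and \<sigma>_win: "\<And>B. (\<And>n. B n \<in> Omega Z z) \<Longrightarrow>
      z \<in> Z closure_of (range (\<lambda>n. \<sigma> (map B [0..<Suc n])))"
    using win unfolding II_wins_SCFT_def SCFT_winning_strategy_def by blast
  define \<tau> where "\<tau> As = p (length As - 1) (last As) (\<sigma> (push_moves t As))" for As
  have legal: "\<sigma> (push_moves t As) \<in> t (length As - 1) (last As)"
    if "As \<noteq> []" "set As \<subseteq> Omega Y y" for As
    using \<sigma> push_moves_legal [where t = t, OF that push] unfolding SCFT_strategy_def by metis
  have "SCFT_strategy Y y \<tau>"
    unfolding SCFT_strategy_def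
  proof (intro allI impI)
    fix As assume As: "As \<noteq> [] \<and> set As \<subseteq> Omega Y y"
    then have "last As \<in> Omega Y y" by (meson last_in_set subsetD)
    then show "\<tau> As \<in> last As"
      using legal As pull unfolding \<tau>_def by blast
  qed
  moreover have "y \<in> Y closure_of (range (\<lambda>n. \<tau> (map A [0..<Suc n])))"
    if A: "\<forall>n. A n \<in> Omega Y y" for A
  proof -
    let ?s = "\<lambda>n. \<sigma> (push_moves t (map A [0..<Suc n]))"
    have "?s n \<in> t n (A n)" for n
      using legal [of "map A [0..<Suc n]"] A by auto
    moreover have "z \<in> Z closure_of (range ?s)"
      unfolding push_moves_upt using A push by (intro \<sigma>_win) blast
    ultimately have "y \<in> Y closure_of (range (\<lambda>n. p n (A n) (?s n)))"
      using A by (intro closure) auto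
    then show ?thesis
      by (simp add: \<tau>_def)
  qed
  ultimately show ?thesis
    unfolding II_wins_SCFT_def SCFT_winning_strategy_def by blast
qed

section \<open>Comparing range spaces\<close>

lemma metrizable_decseq_nhds_base:
  assumes "metrizable_space T" "e \<in> topspace T"
  obtains U :: "nat \<Rightarrow> 'a set" where "\<And>n. openin T (U n)" "\<And>n. e \<in> U n" "decseq U"
    "\<And>V. openin T V \<Longrightarrow> e \<in> V \<Longrightarrow> \<exists>n. U n \<subseteq> V"
proof -
  obtain M d where "Metric_space M d" and T: "T = Metric_space.mtopology M d"
    using assms(1) unfolding metrizable_space_def by blast
  then interpret Metric_space M d by simp
  \<comment> \<open>\<open>Suc n\<close> keeps the radius positive at \<open>n = 0\<close>.\<close>
  let ?U = "\<lambda>n. mball e (inverse (real (Suc n)))"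
  have e: "e \<in> M" using assms(2) T by simp
  have "decseq ?U"
    by (intro decseq_SucI mball_subset_concentric) (simp add: field_simps)
  moreover have "\<exists>n. ?U n \<subseteq> V" if V: "openin T V" "e \<in> V" for V
  proof -
    obtain r where r: "r > 0" "mball e r \<subseteq> V"
      using V unfolding T openin_mtopology by blast
    obtain n where "inverse (real (Suc n)) < r"
      using reals_Archimedean [OF r(1)] by blast
    then show ?thesis
      using mball_subset_concentric [of "inverse (real (Suc n))" r e] r(2) by (meson less_imp_le subset_trans)
  qed
  ultimately show thesis
    using that [of ?U] e T by simp
qed

text \<open>What the transfer uses of arc-connectedness, localised at one point; it passes to a
  product by keeping the other coordinate fixed.\<close>

definition has_path_from :: "'a topology \<Rightarrow> 'a \<Rightarrow> bool" where
  "has_path_from T e \<longleftrightarrow>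
     (\<exists>\<gamma>. continuous_map (top_of_set {0..1::real}) T \<gamma> \<and> \<gamma> 0 = e \<and> \<gamma> 1 \<noteq> e)"

text \<open>The simulated game is the one over \<open>T'\<close>: the space \<open>T\<close>
  supplies the shrinking neighbourhoods of \<open>e\<close>, and \<open>T'\<close> supplies the path
  used to build step functions.\<close>

lemma II_wins_Cp_transfer:
  assumes X: "infinite (topspace X)" "completely_regular_space X" "Hausdorff_space X"
    and T: "metrizable_space T" "e \<in> topspace T"
    and T': "Hausdorff_space T'" "has_path_from T' e'"
  shows "II_wins_CFT (Cp X T') (\<lambda>x\<in>topspace X. e') \<Longrightarrow> II_wins_CFT (Cp X T) (\<lambda>x\<in>topspace X. e)"
    and "II_wins_SCFT (Cp X T') (\<lambda>x\<in>topspace X. e') \<Longrightarrow> II_wins_SCFT (Cp X T) (\<lambda>x\<in>topspace X. e)"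
proof -
  obtain U where U: "\<And>n::nat. openin T (U n)" "\<And>n. e \<in> U n" "decseq U"
      "\<And>V. openin T V \<Longrightarrow> e \<in> V \<Longrightarrow> \<exists>n. U n \<subseteq> V"
    using metrizable_decseq_nhds_base [OF T] by blast
  obtain \<gamma> g where \<gamma>: "continuous_map (top_of_set {0..1::real}) T' \<gamma>" "\<gamma> 0 = e'" "\<gamma> 1 = g" "g \<noteq> e'"
    using T'(2) unfolding has_path_from_def by blast
  have "\<gamma> \<in> {0..1} \<rightarrow> topspace T'"
    using \<gamma>(1) by (simp add: continuous_map_def)
  then have e': "e' \<in> topspace T'"
    using \<gamma>(2) by force
  let ?t = "\<lambda>n. push_move X T' e' g (U n)"
  let ?p = "\<lambda>n. pull_answer X g (U n)"
  let ?\<Omega> = "Omega (Cp X T) (\<lambda>x\<in>topspace X. e)"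
  have push: "?t n A \<in> Omega (Cp X T') (\<lambda>x\<in>topspace X. e')" if "A \<in> ?\<Omega>" for n A
    using that by (rule push_move_Omega [OF X U(1,2) \<gamma>])
  have pull: "?p n A h \<in> A" if "h \<in> ?t n A" for n A h
    using that by (rule pull_answer(1))
  have closure: "(\<lambda>x\<in>topspace X. e) \<in> Cp X T closure_of (\<Union>n. ?p n (A n) ` S n)"
    if "\<And>n. A n \<in> ?\<Omega>" "\<And>n. finite (S n)" "\<And>n. S n \<subseteq> ?t n (A n)"
      "(\<lambda>x\<in>topspace X. e') \<in> Cp X T' closure_of (\<Union>n. S n)" for A S
    using that by (intro pull_answers_closure [OF U T'(1) e' \<gamma>(4)]) (auto simp: Omega_def)
  show "II_wins_CFT (Cp X T) (\<lambda>x\<in>topspace X. e)"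
    if "II_wins_CFT (Cp X T') (\<lambda>x\<in>topspace X. e')"
    by (rule II_wins_CFT_translate [where t = ?t and p = ?p, OF push pull closure that])
  \<comment> \<open>The strong game is the case in which every finite answer is a singleton.\<close>
  have closure1: "(\<lambda>x\<in>topspace X. e) \<in> Cp X T closure_of (range (\<lambda>n. ?p n (A n) (s n)))"
    if "\<And>n. A n \<in> ?\<Omega>" "\<And>n. s n \<in> ?t n (A n)"
      "(\<lambda>x\<in>topspace X. e') \<in> Cp X T' closure_of (range s)" for A s
    using closure [of A "\<lambda>n. {s n}"] that by (simp add: UNION_singleton_eq_range)
  show "II_wins_SCFT (Cp X T) (\<lambda>x\<in>topspace X. e)"
    if "II_wins_SCFT (Cp X T') (\<lambda>x\<in>topspace X. e')"
    by (rule II_wins_SCFT_translate [where t = ?t and p = ?p, OF push pull closure1 that])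
qed

text \<open>With a countable base and a path on both sides, the transfer applies with the roles of
  \<open>T\<close> and \<open>T'\<close> interchanged.\<close>

lemma II_wins_Cp_iff:
  assumes "infinite (topspace X)" "completely_regular_space X" "Hausdorff_space X"
    and "metrizable_space T" "e \<in> topspace T" "has_path_from T e"
    and "metrizable_space T'" "e' \<in> topspace T'" "has_path_from T' e'"
  shows "II_wins_CFT (Cp X T) (\<lambda>x\<in>topspace X. e) \<longleftrightarrow> II_wins_CFT (Cp X T') (\<lambda>x\<in>topspace X. e')"
    and "II_wins_SCFT (Cp X T) (\<lambda>x\<in>topspace X. e) \<longleftrightarrow> II_wins_SCFT (Cp X T') (\<lambda>x\<in>topspace X. e')"
  using II_wins_Cp_transfer [OF assms(1-5) metrizable_imp_Hausdorff_space [OF assms(7)] assms(9)]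
    II_wins_Cp_transfer [OF assms(1-3,7,8) metrizable_imp_Hausdorff_space [OF assms(4)] assms(6)]
  by blast+

section \<open>Paths in arc-connected groups and products, and the equivalence of the games\<close>

lemma topological_group_one_in_topspace: "topological_group G T \<Longrightarrow> \<one>\<^bsub>G\<^esub> \<in> topspace T"
  by (auto simp: topological_group_def intro: monoid.one_closed group.is_monoid)

text \<open>Non-triviality provides a point other than the identity, and an arc joining the two is
  in particular a continuous path.\<close>

lemma arc_connected_group_has_path_from_one:
  assumes G: "topological_group G T" "carrier G \<noteq> {\<one>\<^bsub>G\<^esub>}" and T: "arc_connected_space T"
  shows "has_path_from T \<one>\<^bsub>G\<^esub>"
proof -
  have one: "\<one>\<^bsub>G\<^esub> \<in> topspace T"
    using G(1) by (rule topological_group_one_in_topspace)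
  moreover have "topspace T = carrier G"
    using G(1) by (simp add: topological_group_def)
  ultimately obtain g where "g \<in> topspace T" "g \<noteq> \<one>\<^bsub>G\<^esub>"
    using G(2) by blast
  then obtain \<gamma> where \<gamma>: "embedding_map (top_of_set {0..1::real}) T \<gamma>" "\<gamma> 0 = \<one>\<^bsub>G\<^esub>" "\<gamma> 1 = g"
    using T one unfolding arc_connected_space_def by metis
  have "continuous_map (top_of_set {0..1::real}) T \<gamma>"
    using \<gamma>(1) unfolding embedding_map_def
    by (meson continuous_map_into_fulltopology homeomorphic_imp_continuous_map)
  then show ?thesis
    using \<gamma> \<open>g \<noteq> \<one>\<^bsub>G\<^esub>\<close> unfolding has_path_from_def by blast
qed

lemma has_path_from_prod:
  assumes "has_path_from S a" "b \<in> topspace T"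
  shows "has_path_from (prod_topology S T) (a, b)"
proof -
  obtain \<gamma> where \<gamma>: "continuous_map (top_of_set {0..1::real}) S \<gamma>" "\<gamma> 0 = a" "\<gamma> 1 \<noteq> a"
    using assms(1) unfolding has_path_from_def by blast
  have "continuous_map (top_of_set {0..1::real}) (prod_topology S T) (\<lambda>t. (\<gamma> t, b))"
    using \<gamma>(1) assms(2) by (simp add: continuous_map_pairedI)
  then show ?thesis
    using \<gamma>(2,3) unfolding has_path_from_def by (intro exI [of _ "\<lambda>t. (\<gamma> t, b)"]) simp
qed

theorem corollary4p1:
  fixes X :: "'x topology"
    and G1 :: "('a, 'm) monoid_scheme" and T1 :: "'a topology"
    and G2 :: "('b, 'n) monoid_scheme" and T2 :: "'b topology"
  assumes "infinite (topspace X)" and "completely_regular_space X" and "Hausdorff_space X"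
    and "topological_group G1 T1" and "carrier G1 \<noteq> {\<one>\<^bsub>G1\<^esub>}"
    and "metrizable_space T1" and "arc_connected_space T1"
    and "topological_group G2 T2" and "carrier G2 \<noteq> {\<one>\<^bsub>G2\<^esub>}"
    and "metrizable_space T2" and "arc_connected_space T2"
  shows "(II_wins_CFT (Cp X T1) (const_one X G1) \<longleftrightarrow> II_wins_CFT (Cp X T2) (const_one X G2))
     \<and> (II_wins_CFT (Cp X (prod_topology T1 T2)) (const_one X (G1 \<times>\<times> G2))
           \<longleftrightarrow> II_wins_CFT (Cp X T1) (const_one X G1))
     \<and> (II_wins_SCFT (Cp X T1) (const_one X G1) \<longleftrightarrow> II_wins_SCFT (Cp X T2) (const_one X G2))
     \<and> (II_wins_SCFT (Cp X (prod_topology T1 T2)) (const_one X (G1 \<times>\<times> G2))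
           \<longleftrightarrow> II_wins_SCFT (Cp X T1) (const_one X G1))"
proof -
  note one1 = topological_group_one_in_topspace [OF assms(4)]
    and one2 = topological_group_one_in_topspace [OF assms(8)]
  note path1 = arc_connected_group_has_path_from_one [OF assms(4,5,7)]
    and path2 = arc_connected_group_has_path_from_one [OF assms(8,9,11)]
  have one_prod: "\<one>\<^bsub>G1 \<times>\<times> G2\<^esub> = (\<one>\<^bsub>G1\<^esub>, \<one>\<^bsub>G2\<^esub>)"
    by (simp add: DirProd_def)
  have metr: "metrizable_space (prod_topology T1 T2)"
    using assms(6,10) by (simp add: metrizable_space_prod_topology)
  have in_prod: "(\<one>\<^bsub>G1\<^esub>, \<one>\<^bsub>G2\<^esub>) \<in> topspace (prod_topology T1 T2)"
    using one1 one2 by simp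
  \<comment> \<open>The product is metrizable and has a path from its identity that moves only in
    the first coordinate, so both claims are instances of one comparison: \<open>T1\<close> with
    \<open>T2\<close>, and the product with \<open>T1\<close>.\<close>
  note eq = II_wins_Cp_iff [OF assms(1-3) assms(6) one1 path1 assms(10) one2 path2]
    and eq_prod = II_wins_Cp_iff [OF assms(1-3) metr in_prod has_path_from_prod [OF path1 one2]
      assms(6) one1 path1]
  show ?thesis
    unfolding const_one_def one_prod using eq eq_prod by blast
qed

end
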